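(* Let $0<\mu\le L$, let $f:\mathbb{R}^n\to\mathbb{R}$ be $L$-smooth and $\mu$-strongly convex, let $g:\mathbb{R}^n\to(-\infty,+\infty]$ be proper, closed and convex, and let $\varphi=f+g$. For $t>0$ put $\rho(t):=\max\{|1-Lt|,\,|1-\mu t|\}$. For $x\in\mathbb{R}^n$ let $x^+=\mathbf{prox}_{tg}(x-t\nabla f(x))=x-t\,\mathcal{G}_t(x)$ be the proximal gradient step. Then for every $t>0$ and every $x\in\mathbb{R}^n$, $$\|\mathcal{G}_t(x^+)\|\le d(0,\partial\varphi(x^+))\le \rho(t)\,\|\mathcal{G}_t(x)\|\le \rho(t)\, d(0,\partial\varphi(x)),$$ and the rate $\rho(t)$ is the exact worst-case linear convergence rate of the proximal gradient method in terms of the proximal gradient norm, i.e. for given $t>0$ and $0<\mu\le L$, $\rho(t)$ cannot be replaced by any smaller constant $c$ such that $\|\mathcal{G}_t(x^+)\|\le c\,\|\mathcal{G}_t(x)\|$ holds for all such $f$, $g$ and all $x\in\mathbb{R}^n$. In particular, if $f:\mathbb{R}^n\to\mathbb{R}$ is only assumed convex and $L$-smooth ($L>0$), $g$ is proper, closed and convex, and $0<t\le \frac{2}{L}$, then for every $x\in\mathbb{R}^n$, $$\|\mathcal{G}_t(x^+)\|\le d(0,\partial\varphi(x^+))\le \|\mathcal{G}_t(x)\|\le d(0,\partial\varphi(x)).$$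
   Context: $\mathbb{R}^n$ ($n\ge 1$) is Euclidean space with inner product $\langle\cdot,\cdot\rangle$ and induced norm $\|\cdot\|$. A differentiable function $f:\mathbb{R}^n\to\mathbb{R}$ is $L$-smooth if $\|\nabla f(x)-\nabla f(y)\|\le L\|x-y\|$ for all $x,y\in\mathbb{R}^n$; it is $\mu$-strongly convex if $x\mapsto f(x)-\frac{\mu}{2}\|x\|^2$ is convex on $\mathbb{R}^n$. For $t>0$ and $g$ proper closed convex, $\mathbf{prox}_{tg}(x):=\arg\min_{u\in\mathbb{R}^n}\{t g(u)+\frac12\|u-x\|^2\}$. The proximal gradient is $\mathcal{G}_t(x):=t^{-1}\left(x-\mathbf{prox}_{tg}(x-t\nabla f(x))\right)$. $\partial\varphi$ denotes the convex subdifferential, and $d(x,S):=\inf_{y\in S}\|x-y\|$, with the convention $d(x,\emptyset)=+\infty$ (and, if $\rho(t)=0$, the last inequality $\rho(t)\|\mathcal{G}_t(x)\|\le\rho(t)d(0,\partial\varphi(x))$ is understood only when $\partial\varphi(x)\neq\emptyset$). *)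

theory Defs
  imports "HOL-Analysis.Analysis"
begin

text \<open>Extended-real-valued functions are modelled with \<^typ>\<open>ereal\<close>; properness excludes
  the value \<open>-\<infinity>\<close>. Closedness (lower semicontinuity) and convexity are those of the epigraph,
  a subset of \<open>'a \<times> real\<close>.\<close>

definition ereal_epigraph :: "('a \<Rightarrow> ereal) \<Rightarrow> ('a \<times> real) set" where
  "ereal_epigraph g = {(x, r). g x \<le> ereal r}"

definition proper_fun :: "('a \<Rightarrow> ereal) \<Rightarrow> bool" where
  "proper_fun g \<longleftrightarrow> (\<forall>x. g x \<noteq> -\<infinity>) \<and> (\<exists>x. g x \<noteq> \<infinity>)"

definition closed_fun :: "('a::euclidean_space \<Rightarrow> ereal) \<Rightarrow> bool" where
  "closed_fun g \<longleftrightarrow> closed (ereal_epigraph g)"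

definition convex_fun :: "('a::euclidean_space \<Rightarrow> ereal) \<Rightarrow> bool" where
  "convex_fun g \<longleftrightarrow> convex (ereal_epigraph g)"

definition proper_closed_convex :: "('a::euclidean_space \<Rightarrow> ereal) \<Rightarrow> bool" where
  "proper_closed_convex g \<longleftrightarrow> proper_fun g \<and> closed_fun g \<and> convex_fun g"

definition grad :: "('a::euclidean_space \<Rightarrow> real) \<Rightarrow> 'a \<Rightarrow> 'a" where
  "grad f x = (THE D. GDERIV f x :> D)"

definition L_smooth :: "real \<Rightarrow> ('a::euclidean_space \<Rightarrow> real) \<Rightarrow> bool" where
  "L_smooth L f \<longleftrightarrow>
     (\<forall>x. f differentiable (at x)) \<and>
     (\<forall>x y. norm (grad f x - grad f y) \<le> L * norm (x - y))"

definition strongly_convex :: "real \<Rightarrow> ('a::euclidean_space \<Rightarrow> real) \<Rightarrow> bool" where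
  "strongly_convex \<mu> f \<longleftrightarrow> convex_on UNIV (\<lambda>x. f x - \<mu> / 2 * (norm x)\<^sup>2)"

text \<open>For proper closed convex \<open>h\<close> the minimiser exists and is unique, so the choice made
  by \<^const>\<open>arg_min_on\<close> is immaterial.\<close>

definition prox :: "('a::euclidean_space \<Rightarrow> ereal) \<Rightarrow> 'a \<Rightarrow> 'a" where
  "prox h x = arg_min_on (\<lambda>u. h u + ereal (1 / 2 * (norm (u - x))\<^sup>2)) UNIV"

definition prox_grad_step ::
  "real \<Rightarrow> ('a::euclidean_space \<Rightarrow> real) \<Rightarrow> ('a \<Rightarrow> ereal) \<Rightarrow> 'a \<Rightarrow> 'a" where
  "prox_grad_step t f g x = prox (\<lambda>u. ereal t * g u) (x - t *\<^sub>R grad f x)"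

definition prox_gradient ::
  "real \<Rightarrow> ('a::euclidean_space \<Rightarrow> real) \<Rightarrow> ('a \<Rightarrow> ereal) \<Rightarrow> 'a \<Rightarrow> 'a" where
  "prox_gradient t f g x =
     inverse t *\<^sub>R (x - prox (\<lambda>u. ereal t * g u) (x - t *\<^sub>R grad f x))"

text \<open>For proper \<open>\<phi>\<close> this set is empty at points where \<open>\<phi>\<close> takes the value \<open>\<infinity>\<close>.\<close>

definition subdiff :: "('a::euclidean_space \<Rightarrow> ereal) \<Rightarrow> 'a \<Rightarrow> 'a set" where
  "subdiff \<phi> x = {v. \<forall>y. \<phi> y \<ge> \<phi> x + ereal (inner v (y - x))}"

text \<open>Unlike \<^const>\<open>infdist\<close>, the distance to the empty set is \<open>\<infinity>\<close>. Since \<open>0 * \<infinity> = 0\<close> in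
  \<^typ>\<open>ereal\<close>, a bound \<open>0 \<le> 0 * dist_to x {}\<close> reads \<open>0 \<le> 0\<close>.\<close>

definition dist_to :: "'a::euclidean_space \<Rightarrow> 'a set \<Rightarrow> ereal" where
  "dist_to x S = (INF y\<in>S. ereal (norm (x - y)))"

definition composite :: "('a \<Rightarrow> real) \<Rightarrow> ('a \<Rightarrow> ereal) \<Rightarrow> 'a \<Rightarrow> ereal" where
  "composite f g x = ereal (f x) + g x"

definition rate :: "real \<Rightarrow> real \<Rightarrow> real \<Rightarrow> real" where
  "rate \<mu> L t = max \<bar>1 - L * t\<bar> \<bar>1 - \<mu> * t\<bar>"

lemma grad_eqI:
  assumes "GDERIV f x :> D"
  shows "grad f x = D"
  unfolding grad_def
proof (rule the_equality, rule assms)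
  fix E assume "GDERIV f x :> E"
  with assms have "(\<lambda>h. inner h E) = (\<lambda>h. inner h D)"
    unfolding gderiv_def using has_derivative_unique by blast
  then show "E = D"
    using vector_eq_ldot by metis
qed

lemma differentiable_imp_GDERIV_grad:
  assumes "f differentiable (at x)"
  shows "GDERIV f x :> grad f x"
proof -
  from assms obtain f' where f': "(f has_derivative f') (at x)"
    unfolding differentiable_def by blast
  then interpret bounded_linear f' by (rule has_derivative_bounded_linear)
  have "f' h = inner h (adjoint f' 1)" for h
    using adjoint_works[OF linear_axioms, of h 1] by simp
  then have "f' = (\<lambda>h. inner h (adjoint f' 1))" by blast
  then have "GDERIV f x :> adjoint f' 1"
    using f' unfolding gderiv_def by simp
  then show ?thesis by (simp add: grad_eqI)
qed

lemma prox_grad_step_eq: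
  "t \<noteq> 0 \<Longrightarrow> prox_grad_step t f g x = x - t *\<^sub>R prox_gradient t f g x"
  by (simp add: prox_grad_step_def prox_gradient_def)

end

theory Submission
  imports Defs
begin

text \<open>The proof rests on the optimality condition of the proximal map, \<open>p = prox\<^sub>h z\<close> only if
  \<open>z - p \<in> \<partial>h p\<close>. It says that the proximal gradient satisfies
  \<open>G x - \<nabla>f x \<in> \<partial>g x\<^sup>+\<close> (\<open>prox_gradient_in_subdiff\<close>).

  Since \<open>\<partial>g\<close> is monotone, the map \<open>p + t u \<mapsto> p\<close> for \<open>u \<in> \<partial>g p\<close> is nonexpansive. A
  subgradient of \<open>\<phi>\<close> at \<open>x\<close> has the form \<open>v = \<nabla>f x + u\<close> with \<open>u \<in> \<partial>g x\<close>, so that \<open>x\<close> and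
  \<open>x\<^sup>+\<close> are the images of inputs at distance \<open>t \<parallel>v\<parallel>\<close>; hence \<open>\<parallel>G x\<parallel> \<le> \<parallel>v\<parallel>\<close>
  (\<open>norm_prox_gradient_le_dist_to\<close>). This gives both outer inequalities.

  For the middle one, \<open>\<nabla>f x\<^sup>+ + (G x - \<nabla>f x)\<close> is a subgradient of \<open>\<phi>\<close> at \<open>x\<^sup>+\<close>, and
  \<open>t\<close> times it is the difference of the values of \<open>id - t \<nabla>f\<close> at \<open>x\<close> and \<open>x\<^sup>+\<close>
  (\<open>dist_to_subdiff_step_le\<close>). It remains to see that \<open>id - t \<nabla>f\<close> has Lipschitz modulus
  \<open>\<rho>(t)\<close> (\<open>gradient_step_lipschitz\<close>): by cocoercivity of the gradient of
  \<open>f - \<mu>/2 \<parallel>\<cdot>\<parallel>\<^sup>2\<close>, the difference \<open>\<nabla>f y - \<nabla>f x\<close> lies in the ball with diameter from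
  \<open>\<mu> (y - x)\<close> to \<open>L (y - x)\<close>, as if \<open>f\<close> were quadratic with spectrum in \<open>[\<mu>, L]\<close>.

  The quadratics \<open>a/2 \<parallel>\<cdot>\<parallel>\<^sup>2\<close> with \<open>a = \<mu>\<close> and \<open>a = L\<close> and \<open>g = 0\<close> show that the rate is
  attained. The merely convex case is \<open>\<mu> = 0\<close>, where \<open>\<rho>(t) = 1\<close> as long as \<open>t \<le> 2 / L\<close>.\<close>

section \<open>Extended-real-valued convex functions and their subdifferentials\<close>

lemma proper_closed_convexD:
  assumes "proper_closed_convex g"
  shows "proper_fun g" "closed (ereal_epigraph g)" "convex_fun g"
  using assms by (auto simp: proper_closed_convex_def closed_fun_def)

lemma convex_fun_segment:
  assumes g: "convex_fun g" and "g x \<le> ereal a" "g y \<le> ereal b" and s: "0 \<le> s" "s \<le> 1"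
  shows "g (x + s *\<^sub>R (y - x)) \<le> ereal ((1 - s) * a + s * b)"
proof -
  have "(1 - s) *\<^sub>R (x, a) + s *\<^sub>R (y, b) \<in> ereal_epigraph g"
    using assms unfolding convex_fun_def
    by (intro convexD) (auto simp: ereal_epigraph_def)
  moreover have "(1 - s) *\<^sub>R x + s *\<^sub>R y = x + s *\<^sub>R (y - x)"
    by (simp add: algebra_simps)
  ultimately show ?thesis
    by (simp add: ereal_epigraph_def)
qed

lemma subdiff_imp_finite:
  assumes "proper_fun g" "v \<in> subdiff g x"
  obtains a where "g x = ereal a"
proof -
  obtain y where "g y \<noteq> \<infinity>" "g x \<noteq> - \<infinity>"
    using assms(1) by (auto simp: proper_fun_def)
  moreover have "g x + ereal (v \<bullet> (y - x)) \<le> g y"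
    using assms(2) by (simp add: subdiff_def)
  ultimately show ?thesis
    using that by (cases "g x") auto
qed

lemma subdiff_monotone:
  assumes g: "proper_fun g" and u: "u \<in> subdiff g p" and v: "v \<in> subdiff g q"
  shows "0 \<le> (u - v) \<bullet> (p - q)"
proof -
  obtain a b where ab: "g p = ereal a" "g q = ereal b"
    using subdiff_imp_finite[OF g u] subdiff_imp_finite[OF g v] by metis
  have "g p + ereal (u \<bullet> (q - p)) \<le> g q" "g q + ereal (v \<bullet> (p - q)) \<le> g p"
    using u v by (simp_all add: subdiff_def)
  then show ?thesis
    by (simp add: ab inner_diff_left inner_diff_right)
qed

text \<open>The resolvent \<open>(id + t \<partial>g)\<^sup>-\<^sup>1\<close> is nonexpansive, stated for points of the graph of
  \<open>\<partial>g\<close>: monotonicity makes the cross term nonnegative when \<open>p - q\<close> is tested against the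
  difference of the inputs.\<close>

lemma resolvent_nonexpansive:
  assumes g: "proper_fun g" and u: "u \<in> subdiff g p" and v: "v \<in> subdiff g q" and t: "0 \<le> t"
  shows "norm (p - q) \<le> norm ((p + t *\<^sub>R u) - (q + t *\<^sub>R v))"
proof -
  let ?w = "(p + t *\<^sub>R u) - (q + t *\<^sub>R v)"
  have "(norm (p - q))\<^sup>2 \<le> (norm (p - q))\<^sup>2 + t * ((u - v) \<bullet> (p - q))"
    using subdiff_monotone[OF g u v] t by simp
  also have "\<dots> = ?w \<bullet> (p - q)"
    by (simp add: power2_norm_eq_inner algebra_simps)
  also have "\<dots> \<le> norm ?w * norm (p - q)"
    by (rule norm_cauchy_schwarz)
  finally show ?thesis
    by (cases "p = q") (auto simp: power2_eq_square)
qed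

lemma subdiff_scale:
  assumes g: "proper_fun g" and t: "0 < t" and v: "v \<in> subdiff (\<lambda>u. ereal t * g u) x"
  shows "inverse t *\<^sub>R v \<in> subdiff g x"
proof -
  have p: "proper_fun (\<lambda>u. ereal t * g u)"
    using g t unfolding proper_fun_def by (auto simp: ereal_mult_eq_MInfty ereal_mult_eq_PInfty)
  obtain r where "ereal t * g x = ereal r"
    using subdiff_imp_finite[OF p v] .
  then obtain a where a: "g x = ereal a"
    using t by (cases "g x") auto
  have "g x + ereal (inverse t *\<^sub>R v \<bullet> (y - x)) \<le> g y" for y
  proof (cases "g y")
    case (real b)
    have "t * a + v \<bullet> (y - x) \<le> t * b"
      using v a real by (auto simp: subdiff_def dest: spec[of _ y])
    then show ?thesis
      using t by (simp add: a real field_simps)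
  qed (use g in \<open>auto simp: proper_fun_def\<close>)
  then show ?thesis
    by (simp add: subdiff_def)
qed

lemma proper_closed_convex_scale:
  assumes g: "proper_closed_convex g" and t: "0 < t"
  shows "proper_closed_convex (\<lambda>u. ereal t * g u)"
proof -
  have "ereal t * g x \<le> ereal r \<longleftrightarrow> g x \<le> ereal (r / t)" for x r
    using t by (cases "g x") (auto simp: field_simps)
  then have epi: "ereal_epigraph (\<lambda>u. ereal t * g u) = (\<lambda>z. (fst z, snd z / t)) -` ereal_epigraph g"
    by (auto simp: ereal_epigraph_def)
  have lin: "linear (\<lambda>z::'a \<times> real. (fst z, snd z / t))"
    by (rule linearI) (auto simp: add_divide_distrib)
  have "closed (ereal_epigraph (\<lambda>u. ereal t * g u))"
    unfolding epi using proper_closed_convexD(2)[OF g] t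
    by (intro closed_vimage continuous_intros) auto
  moreover have "convex (ereal_epigraph (\<lambda>u. ereal t * g u))"
    unfolding epi using proper_closed_convexD(3)[OF g]
    by (intro convex_linear_vimage[OF lin]) (simp add: convex_fun_def)
  moreover have "proper_fun (\<lambda>u. ereal t * g u)"
    using proper_closed_convexD(1)[OF g] t unfolding proper_fun_def
    by (auto simp: ereal_mult_eq_MInfty ereal_mult_eq_PInfty)
  ultimately show ?thesis
    by (simp add: proper_closed_convex_def closed_fun_def convex_fun_def)
qed

lemma GDERIV_directional_lower_bound:
  assumes D: "GDERIV f x :> D" and le: "\<And>s. 0 < s \<Longrightarrow> s < 1 \<Longrightarrow> s * c \<le> f (x + s *\<^sub>R e) - f x"
  shows "c \<le> D \<bullet> e"
proof -
  have "((\<lambda>s. x + s *\<^sub>R e) has_derivative (\<lambda>s. s *\<^sub>R e)) (at 0)"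
    by (auto intro!: derivative_eq_intros)
  moreover have "(f has_derivative (\<lambda>h. h \<bullet> D)) (at (x + 0 *\<^sub>R e))"
    using D by (simp add: gderiv_def)
  ultimately have "((\<lambda>s. f (x + s *\<^sub>R e)) has_derivative (\<lambda>s. (s *\<^sub>R e) \<bullet> D)) (at 0)"
    by (rule has_derivative_compose)
  then have "((\<lambda>s. f (x + s *\<^sub>R e)) has_real_derivative D \<bullet> e) (at 0)"
    by (rule has_derivative_imp_has_field_derivative) (simp add: inner_commute)
  then have "((\<lambda>s. (f (x + s *\<^sub>R e) - f x) / s) \<longlongrightarrow> D \<bullet> e) (at 0)"
    by (simp add: DERIV_def)
  then have lim: "((\<lambda>s. (f (x + s *\<^sub>R e) - f x) / s) \<longlongrightarrow> D \<bullet> e) (at_right 0)"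
    by (rule filterlim_mono) (auto simp: at_le)
  have "\<forall>\<^sub>F s in at_right 0. c \<le> (f (x + s *\<^sub>R e) - f x) / s"
    using eventually_at_right_real[of 0 "1::real", OF zero_less_one]
    by (rule eventually_mono) (use le in \<open>auto simp: field_simps\<close>)
  then show ?thesis
    by (intro tendsto_lowerbound[OF lim]) auto
qed

text \<open>One half of the sum rule. Moving from \<open>x\<close> towards
  \<open>y\<close> by a fraction \<open>s\<close>, convexity bounds the change of \<open>g\<close> by \<open>s (g y - g x)\<close>, and the rest is
  a first-order statement about \<open>f\<close>. Applied to a minimiser (with \<open>v = 0\<close>) this is Fermat's rule,
  which is how the optimality condition of the proximal map is obtained below.\<close>

lemma subdiff_composite_imp_diff_grad:
  assumes D: "GDERIV f x :> D" and g: "proper_fun g" "convex_fun g"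
    and v: "v \<in> subdiff (composite f g) x"
  shows "v - D \<in> subdiff g x"
proof -
  have p: "proper_fun (composite f g)"
    using g by (auto simp: proper_fun_def composite_def)
  obtain r where "composite f g x = ereal r"
    using subdiff_imp_finite[OF p v] .
  then obtain a where a: "g x = ereal a"
    by (cases "g x") (auto simp: composite_def)
  have "g x + ereal ((v - D) \<bullet> (y - x)) \<le> g y" for y
  proof (cases "g y")
    case (real b)
    have "s * (v \<bullet> (y - x) + a - b) \<le> f (x + s *\<^sub>R (y - x)) - f x" if s: "0 < s" "s < 1" for s
    proof -
      let ?z = "x + s *\<^sub>R (y - x)"
      have "composite f g x + ereal (v \<bullet> (?z - x)) \<le> composite f g ?z"
        using v unfolding subdiff_def by blast
      also have "\<dots> \<le> ereal (f ?z) + ereal ((1 - s) * a + s * b)"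
        unfolding composite_def using g(2) a real s
        by (intro add_left_mono convex_fun_segment) auto
      finally have "f x + a + s * (v \<bullet> (y - x)) \<le> f ?z + ((1 - s) * a + s * b)"
        by (simp add: composite_def a)
      then show ?thesis
        by (simp add: algebra_simps)
    qed
    from GDERIV_directional_lower_bound[OF D this] show ?thesis
      by (simp add: a real inner_diff_left)
  qed (use g in \<open>auto simp: proper_fun_def\<close>)
  then show ?thesis
    by (simp add: subdiff_def)
qed

lemma add_grad_in_subdiff_composite:
  assumes f: "\<And>y. f x + D \<bullet> (y - x) \<le> f y" and v: "v \<in> subdiff g x"
  shows "D + v \<in> subdiff (composite f g) x"
proof -
  have "composite f g x + ereal ((D + v) \<bullet> (y - x)) \<le> composite f g y" for y
  proof -
    have "composite f g x + ereal ((D + v) \<bullet> (y - x)) =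
        ereal (f x + D \<bullet> (y - x)) + (g x + ereal (v \<bullet> (y - x)))"
      by (cases "g x") (simp_all add: composite_def inner_add_left)
    also have "\<dots> \<le> composite f g y"
      unfolding composite_def using f[of y] v by (intro add_mono) (auto simp: subdiff_def)
    finally show ?thesis .
  qed
  then show ?thesis
    by (simp add: subdiff_def)
qed

section \<open>Existence and optimality condition of the proximal point\<close>

text \<open>Coercivity of the proximal objective rests on this bound: \<open>h\<close> falls off at most
  linearly. Lower semicontinuity bounds \<open>h\<close> below on the unit ball around a point of the domain,
  since otherwise the nested compact sublevel sets would share a point of value \<open>-\<infinity>\<close>; convexity
  transports the bound along rays out of the ball.\<close>

lemma proper_closed_convex_linear_minorant:
  assumes h: "proper_closed_convex h" and a: "h x0 = ereal a"
  obtains b where "0 \<le> b" "\<And>u. ereal (a - b - b * norm (u - x0)) \<le> h u"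
proof -
  note hD = proper_closed_convexD[OF h]
  have "\<exists>n::nat. \<forall>u \<in> cball x0 1. ereal (- real n) \<le> h u"
  proof (rule ccontr)
    assume contra: "\<not> ?thesis"
    define E where "E n = cball x0 1 \<inter> (\<lambda>u. (u, - real n)) -` ereal_epigraph h" for n :: nat
    have "compact (E n)" for n
      unfolding E_def using hD(2)
      by (intro compact_Int_closed closed_vimage continuous_intros) auto
    moreover have "E n \<noteq> {}" for n
      using contra by (force simp: E_def ereal_epigraph_def not_le intro: less_imp_le)
    moreover have "E n \<subseteq> E m" if "m \<le> n" for m n
      using that by (auto simp: E_def ereal_epigraph_def elim!: order_trans)
    ultimately have "\<Inter> (range E) \<noteq> {}"
      by (rule compact_nest)
    then obtain w where "\<And>n. w \<in> E n"
      by auto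
    then have w: "h w \<le> ereal (- real n)" for n
      by (auto simp: E_def ereal_epigraph_def)
    show False
    proof (cases "h w")
      case (real r)
      obtain n where "- r < real n"
        using reals_Archimedean2 by blast
      then show False
        using w[of n] real by simp
    next
      case PInf
      then show False using w[of 0] by simp
    next
      case MInf
      then show False using hD(1) by (simp add: proper_fun_def)
    qed
  qed
  then obtain n :: nat where n: "\<forall>u \<in> cball x0 1. ereal (- real n) \<le> h u"
    by blast
  define m where "m = - real n"
  have m: "ereal m \<le> h u" if "norm (u - x0) \<le> 1" for u
    using n that by (simp add: m_def dist_norm norm_minus_commute)
  have am: "m \<le> a"
    using m[of x0] a by simp
  show ?thesis
  proof (rule that[of "a - m"])
    show "0 \<le> a - m"
      using am by simp
    fix u
    let ?d = "norm (u - x0)"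
    show "ereal (a - (a - m) - (a - m) * ?d) \<le> h u"
    proof (cases "?d \<le> 1")
      case True
      have "ereal (a - (a - m) - (a - m) * ?d) \<le> ereal m"
        using am by simp
      also have "\<dots> \<le> h u"
        using m True .
      finally show ?thesis .
    next
      case False
      then have d: "1 < ?d"
        by simp
      show ?thesis
      proof (cases "h u")
        case (real r)
        let ?s = "1 / ?d"
        have "0 < ?d"
          using d by linarith
        then have s: "0 \<le> ?s" "?s \<le> 1"
          using d by (simp, subst divide_le_eq_1_pos) auto
        have "ereal m \<le> h (x0 + ?s *\<^sub>R (u - x0))"
          using d by (intro m) auto
        also have "\<dots> \<le> ereal ((1 - ?s) * a + ?s * r)"
          using hD(3) a real s by (intro convex_fun_segment) auto
        finally have "m \<le> (1 - ?s) * a + ?s * r"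
          by simp
        then have "?d * m \<le> ?d * ((1 - ?s) * a + ?s * r)"
          by (intro mult_left_mono) auto
        also have "\<dots> = (?d - 1) * a + r"
          using d by (auto simp: field_simps)
        finally have "a - (a - m) * ?d \<le> r"
          by (simp add: algebra_simps)
        then show ?thesis
          using am real by simp
      qed (use hD(1) in \<open>auto simp: proper_fun_def\<close>)
    qed
  qed
qed

text \<open>Minimising \<open>h u + \<parallel>u - z\<parallel>\<^sup>2 / 2\<close> amounts to minimising the continuous function
  \<open>r + \<parallel>u - z\<parallel>\<^sup>2 / 2\<close> over the closed epigraph of \<open>h\<close>; the linear minorant confines
  the relevant sublevel set to a box, so that compactness applies.\<close>

lemma prox_objective_has_minimiser:
  assumes h: "proper_closed_convex h"
  shows "\<exists>p. \<forall>y. h p + ereal (1 / 2 * (norm (p - z))\<^sup>2) \<le> h y + ereal (1 / 2 * (norm (y - z))\<^sup>2)"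
proof -
  note hD = proper_closed_convexD[OF h]
  obtain x0 where "h x0 \<noteq> \<infinity>" "h x0 \<noteq> - \<infinity>"
    using hD(1) by (auto simp: proper_fun_def)
  then obtain a where a: "h x0 = ereal a"
    by (cases "h x0") auto
  obtain b where b: "0 \<le> b" "\<And>u. ereal (a - b - b * norm (u - x0)) \<le> h u"
    by (rule proper_closed_convex_linear_minorant[OF h a]) blast
  \<comment> \<open>With \<open>n = \<parallel>u - z\<parallel>\<close>, a value of at most \<open>M\<close> forces \<open>n\<^sup>2 \<le> 2 C + 2 b n\<close> by the minorant,
    hence \<open>n \<le> R\<close>; the minorant on that ball then gives \<open>lo\<close>.\<close>
  define k where "k = norm (z - x0)"
  define F where "F w = snd w + 1 / 2 * (norm (fst w - z))\<^sup>2" for w :: "'a \<times> real"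
  define M where "M = F (x0, a)"
  define C where "C = \<bar>M - a + b + b * k\<bar>"
  define R where "R = 1 + 2 * C + 2 * b"
  define lo where "lo = a - b - b * (R + k)"
  define K where "K = ereal_epigraph h \<inter> (cball z R \<times> {lo..M})"
  have sub: "(u, r) \<in> K" if ur: "h u \<le> ereal r" and FM: "F (u, r) \<le> M" for u r
  proof -
    let ?n = "norm (u - z)"
    have nx: "norm (u - x0) \<le> ?n + k"
      unfolding k_def using norm_triangle_ineq[of "u - z" "z - x0"] by simp
    have "a - b - b * norm (u - x0) \<le> r"
      using order_trans[OF b(2) ur] by simp
    moreover have "b * norm (u - x0) \<le> b * (?n + k)"
      using nx b(1) by (rule mult_left_mono)
    ultimately have r: "a - b - b * (?n + k) \<le> r"
      by simp
    have rM: "r + 1 / 2 * ?n\<^sup>2 \<le> M"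
      using FM by (simp add: F_def)
    have C: "M - a + b + b * k \<le> C" "0 \<le> C"
      by (simp_all add: C_def)
    then have n2: "?n * ?n \<le> 2 * C + 2 * b * ?n"
      using r rM by (simp add: power2_eq_square algebra_simps)
    have "?n \<le> R"
    proof (cases "?n \<le> 1")
      case True
      then show ?thesis
        using b(1) C by (simp add: R_def)
    next
      case False
      have "2 * C * 1 \<le> 2 * C * ?n"
        using False by (intro mult_left_mono) (auto simp: C_def)
      then have "?n * ?n \<le> (2 * C + 2 * b) * ?n"
        using n2 by (simp add: algebra_simps)
      then have "?n \<le> 2 * C + 2 * b"
        using False by (intro mult_right_le_imp_le[of ?n ?n "2 * C + 2 * b"]) auto
      then show ?thesis
        by (simp add: R_def)
    qed
    moreover have "lo \<le> r"
    proof -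
      have "b * (?n + k) \<le> b * (R + k)"
        using \<open>?n \<le> R\<close> b(1) by (intro mult_left_mono) auto
      then show ?thesis
        using r by (simp add: lo_def)
    qed
    moreover have "r \<le> M"
      using rM zero_le_power2[of ?n] by linarith
    ultimately show ?thesis
      using ur by (simp add: K_def ereal_epigraph_def dist_norm norm_minus_commute)
  qed
  have "compact K"
    unfolding K_def using hD(2)
    by (intro closed_Int_compact compact_Times) auto
  moreover have x0K: "(x0, a) \<in> K"
    by (rule sub) (simp_all add: a M_def)
  moreover have "continuous_on K F"
    unfolding F_def by (intro continuous_intros)
  ultimately obtain w where w: "w \<in> K" "\<forall>v\<in>K. F w \<le> F v"
    using continuous_attains_inf[of K F] by blast
  obtain p r where pr: "w = (p, r)"
    by (cases w)
  have hp: "h p \<le> ereal r"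
    using w(1) by (simp add: pr K_def ereal_epigraph_def)
  have "h p + ereal (1 / 2 * (norm (p - z))\<^sup>2) \<le> h y + ereal (1 / 2 * (norm (y - z))\<^sup>2)" for y
  proof (cases "h y")
    case (real c)
    have "F (p, r) \<le> F (y, c)"
    proof (cases "F (y, c) \<le> M")
      case True
      then show ?thesis
        using sub[of y c] real w(2) pr by simp
    next
      case False
      then show ?thesis
        using w(2) x0K pr M_def by fastforce
    qed
    then have "ereal r + ereal (1 / 2 * (norm (p - z))\<^sup>2) \<le> h y + ereal (1 / 2 * (norm (y - z))\<^sup>2)"
      by (simp add: F_def real)
    moreover have "h p + ereal (1 / 2 * (norm (p - z))\<^sup>2) \<le> ereal r + ereal (1 / 2 * (norm (p - z))\<^sup>2)"
      using hp by (rule add_right_mono)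
    ultimately show ?thesis
      by (rule order_trans[rotated])
  qed (use hD(1) in \<open>auto simp: proper_fun_def\<close>)
  then show ?thesis
    by blast
qed

lemma GDERIV_half_norm_diff_sq: "GDERIV (\<lambda>u. 1 / 2 * (norm (u - z))\<^sup>2) x :> x - z"
  unfolding gderiv_def power2_norm_eq_inner
  by (auto intro!: derivative_eq_intros simp: inner_commute algebra_simps)

lemma prox_in_subdiff:
  assumes h: "proper_closed_convex h"
  shows "z - prox h z \<in> subdiff h (prox h z)"
proof -
  let ?q = "\<lambda>u. 1 / 2 * (norm (u - z))\<^sup>2" and ?p = "prox h z"
  obtain p where p: "\<And>y. h p + ereal (?q p) \<le> h y + ereal (?q y)"
    using prox_objective_has_minimiser[OF h, of z] by blast
  have "is_arg_min (\<lambda>u. h u + ereal (?q u)) (\<lambda>u. u \<in> UNIV) ?p"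
    unfolding prox_def arg_min_on_def arg_min_def
    by (rule someI[of _ p]) (use p in \<open>auto simp: is_arg_min_linorder\<close>)
  then have "h ?p + ereal (?q ?p) \<le> h y + ereal (?q y)" for y
    by (auto simp: is_arg_min_linorder)
  then have "0 \<in> subdiff (composite ?q h) ?p"
    by (simp add: subdiff_def composite_def add.commute)
  from subdiff_composite_imp_diff_grad[OF GDERIV_half_norm_diff_sq _ _ this]
  show ?thesis
    using proper_closed_convexD[OF h] by simp
qed

lemma prox_gradient_in_subdiff:
  assumes g: "proper_closed_convex g" and t: "0 < t"
  shows "prox_gradient t f g x - grad f x \<in> subdiff g (prox_grad_step t f g x)"
proof -
  let ?h = "\<lambda>u. ereal t * g u" and ?z = "x - t *\<^sub>R grad f x"
  have "?z - prox ?h ?z \<in> subdiff ?h (prox ?h ?z)"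
    by (rule prox_in_subdiff[OF proper_closed_convex_scale[OF g t]])
  from subdiff_scale[OF proper_closed_convexD(1)[OF g] t this]
  have "inverse t *\<^sub>R (?z - prox ?h ?z) \<in> subdiff g (prox ?h ?z)" .
  moreover have "inverse t *\<^sub>R (?z - prox ?h ?z) = prox_gradient t f g x - grad f x"
    using t by (simp add: prox_gradient_def algebra_simps)
  ultimately show ?thesis
    by (simp add: prox_grad_step_def)
qed

section \<open>Lipschitz modulus of the gradient step\<close>

lemma L_smooth_GDERIV: "L_smooth L f \<Longrightarrow> GDERIV f x :> grad f x"
  by (simp add: L_smooth_def differentiable_imp_GDERIV_grad)

lemma convex_on_GDERIV_lower_bound:
  assumes f: "convex_on UNIV f" and D: "GDERIV f x :> D"
  shows "f x + D \<bullet> (y - x) \<le> f y"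
proof -
  have "GDERIV (\<lambda>u. - f u) x :> - D"
    using D unfolding gderiv_def by (auto intro!: derivative_eq_intros)
  moreover have "s * (f x - f y) \<le> - f (x + s *\<^sub>R (y - x)) - - f x" if "0 < s" "s < 1" for s
  proof -
    have "f ((1 - s) *\<^sub>R x + s *\<^sub>R y) \<le> (1 - s) * f x + s * f y"
      using f that by (intro convex_onD) auto
    moreover have "(1 - s) *\<^sub>R x + s *\<^sub>R y = x + s *\<^sub>R (y - x)"
      by (simp add: algebra_simps)
    ultimately show ?thesis
      by (simp add: algebra_simps)
  qed
  ultimately have "f x - f y \<le> - D \<bullet> (y - x)"
    by (rule GDERIV_directional_lower_bound)
  then show ?thesis
    by simp
qed

lemma strongly_convex_lower_bound:
  assumes f: "strongly_convex \<mu> f" and D: "GDERIV f x :> D"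
  shows "f x + D \<bullet> (y - x) + \<mu> / 2 * (norm (y - x))\<^sup>2 \<le> f y"
proof -
  have "GDERIV (\<lambda>u. f u - \<mu> / 2 * (norm u)\<^sup>2) x :> D - \<mu> *\<^sub>R x"
    using D unfolding gderiv_def power2_norm_eq_inner
    by (auto intro!: derivative_eq_intros simp: inner_commute algebra_simps)
  from convex_on_GDERIV_lower_bound[OF f[unfolded strongly_convex_def] this, of y]
  show ?thesis
    by (simp add: power2_norm_eq_inner inner_commute algebra_simps)
qed

lemma L_smooth_upper_bound:
  assumes f: "L_smooth L f"
  shows "f y \<le> f x + grad f x \<bullet> (y - x) + L / 2 * (norm (y - x))\<^sup>2"
proof -
  let ?e = "y - x"
  let ?q = "\<lambda>s. f (x + s *\<^sub>R ?e) - s * (grad f x \<bullet> ?e) - L / 2 * s\<^sup>2 * (norm ?e)\<^sup>2"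
  let ?q' = "\<lambda>s. (grad f (x + s *\<^sub>R ?e) - grad f x) \<bullet> ?e - L * s * (norm ?e)\<^sup>2"
  have der: "(?q has_real_derivative ?q' s) (at s)" for s
  proof -
    have "((\<lambda>s. x + s *\<^sub>R ?e) has_derivative (\<lambda>s. s *\<^sub>R ?e)) (at s)"
      by (auto intro!: derivative_eq_intros)
    moreover have "(f has_derivative (\<lambda>h. h \<bullet> grad f (x + s *\<^sub>R ?e))) (at (x + s *\<^sub>R ?e))"
      using L_smooth_GDERIV[OF f] by (simp add: gderiv_def)
    ultimately have "((\<lambda>s. f (x + s *\<^sub>R ?e)) has_derivative
        (\<lambda>r. (r *\<^sub>R ?e) \<bullet> grad f (x + s *\<^sub>R ?e))) (at s)"
      by (rule has_derivative_compose)
    then have "((\<lambda>s. f (x + s *\<^sub>R ?e)) has_real_derivative grad f (x + s *\<^sub>R ?e) \<bullet> ?e) (at s)"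
      by (rule has_derivative_imp_has_field_derivative) (simp add: inner_commute)
    then show ?thesis
      by (auto intro!: derivative_eq_intros simp: inner_diff_left)
  qed
  have "?q 1 \<le> ?q 0"
  proof (rule DERIV_nonpos_imp_nonincreasing[of 0 1 ?q])
    fix s :: real
    assume s: "0 \<le> s" "s \<le> 1"
    have "(grad f (x + s *\<^sub>R ?e) - grad f x) \<bullet> ?e \<le> norm (grad f (x + s *\<^sub>R ?e) - grad f x) * norm ?e"
      by (rule norm_cauchy_schwarz)
    also have "\<dots> \<le> (L * norm ((x + s *\<^sub>R ?e) - x)) * norm ?e"
      using f unfolding L_smooth_def by (intro mult_right_mono norm_ge_zero) blast
    also have "\<dots> = L * s * (norm ?e)\<^sup>2"
      using s by (simp add: power2_eq_square)
    finally show "\<exists>d. (?q has_real_derivative d) (at s) \<and> d \<le> 0"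
      using der[of s] by (intro exI[of _ "?q' s"]) simp
  qed simp
  then show ?thesis
    by simp
qed

text \<open>Cocoercivity (Baillon--Haddad). The lower bound is used at \<open>x\<close> and the upper one at \<open>y\<close>,
  both evaluated at the trial point \<open>y - s (D y - D x)\<close>; the optimal step is \<open>s = 1 / K\<close>, and for
  \<open>K = 0\<close> arbitrarily large steps force \<open>D y = D x\<close>. Adding the resulting inequality to the one
  with \<open>x\<close> and \<open>y\<close> exchanged eliminates the values of \<open>h\<close>.\<close>

lemma quadratic_bounds_imp_cocoercive:
  fixes h :: "'a::euclidean_space \<Rightarrow> real"
  assumes lower: "\<And>x y. h x + D x \<bullet> (y - x) \<le> h y"
    and upper: "\<And>x y. h y \<le> h x + D x \<bullet> (y - x) + K / 2 * (norm (y - x))\<^sup>2"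
    and K: "0 \<le> K"
  shows "(norm (D y - D x))\<^sup>2 \<le> K * ((D y - D x) \<bullet> (y - x))"
proof -
  have half: "h x + D x \<bullet> (y - x) + (s - K / 2 * s\<^sup>2) * (norm (D y - D x))\<^sup>2 \<le> h y" for x y s
  proof -
    let ?z = "y - s *\<^sub>R (D y - D x)"
    have "h x + D x \<bullet> (?z - x) \<le> h y + D y \<bullet> (?z - y) + K / 2 * (norm (?z - y))\<^sup>2"
      using lower[of x ?z] upper[of ?z y] by linarith
    moreover have "K / 2 * (norm (?z - y))\<^sup>2 = K / 2 * (s\<^sup>2 * (norm (D y - D x))\<^sup>2)"
      by (simp add: power_mult_distrib)
    moreover have "D x \<bullet> (?z - x) = D x \<bullet> (y - x) - s * (D x \<bullet> (D y - D x))"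
      "D y \<bullet> (?z - y) = - s * (D y \<bullet> (D y - D x))"
      by (simp_all add: inner_diff_right algebra_simps)
    moreover have "(norm (D y - D x))\<^sup>2 = D y \<bullet> (D y - D x) - D x \<bullet> (D y - D x)"
      by (simp add: power2_norm_eq_inner inner_diff_left)
    ultimately show ?thesis
      by (simp only: left_diff_distrib right_diff_distrib)
  qed
  let ?N = "(norm (D y - D x))\<^sup>2" and ?I = "(D y - D x) \<bullet> (y - x)"
  have key: "(2 * s - K * s\<^sup>2) * ?N \<le> ?I" for s
    using half[of x y s] half[of y x s]
    by (simp add: norm_minus_commute inner_diff_left inner_diff_right algebra_simps)
  show ?thesis
  proof (cases "K = 0")
    case False
    with K have "0 < K"
      by simp
    then show ?thesis
      using key[of "1 / K"] by (simp add: field_simps power2_eq_square)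
  next
    case True
    have "?N = 0"
    proof (rule ccontr)
      assume "?N \<noteq> 0"
      then show False
        using key[of "(?I + 1) / (2 * ?N)"] True by simp
    qed
    then show ?thesis
      by (simp add: True)
  qed
qed

text \<open>Cocoercivity of \<open>f - \<mu>/2 \<parallel>\<cdot>\<parallel>\<^sup>2\<close> says geometrically that the gradient difference
  lies in the ball with diameter from \<open>\<mu> (y - x)\<close> to \<open>L (y - x)\<close>.\<close>

lemma grad_diff_in_ball:
  fixes f :: "'a::euclidean_space \<Rightarrow> real"
  assumes f: "L_smooth L f" "strongly_convex \<mu> f" and "\<mu> \<le> L"
  shows "norm ((grad f y - grad f x) - ((L + \<mu>) / 2) *\<^sub>R (y - x)) \<le> (L - \<mu>) / 2 * norm (y - x)"
proof -
  define h where "h u = f u - \<mu> / 2 * (norm u)\<^sup>2" for u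
  define D where "D u = grad f u - \<mu> *\<^sub>R u" for u
  define d where "d = D y - D x"
  have "(norm d)\<^sup>2 \<le> (L - \<mu>) * (d \<bullet> (y - x))"
    unfolding d_def
  proof (rule quadratic_bounds_imp_cocoercive[of h])
    show "h u + D u \<bullet> (w - u) \<le> h w" for u w
      using strongly_convex_lower_bound[OF f(2) L_smooth_GDERIV[OF f(1)], of u w]
      unfolding h_def D_def
      by (simp add: power2_norm_eq_inner inner_commute algebra_simps)
    show "h w \<le> h u + D u \<bullet> (w - u) + (L - \<mu>) / 2 * (norm (w - u))\<^sup>2" for u w
      using L_smooth_upper_bound[OF f(1), of w u]
      unfolding h_def D_def
      by (simp add: power2_norm_eq_inner inner_commute algebra_simps diff_divide_distrib)
  qed (use assms in simp)
  moreover have "(norm (d - c *\<^sub>R e))\<^sup>2 = (norm d)\<^sup>2 - 2 * c * (d \<bullet> e) + (c * norm e)\<^sup>2"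
    for c :: real and e :: 'a
    unfolding power_mult_distrib power2_norm_eq_inner
    by (simp add: inner_diff_left inner_diff_right inner_commute power2_eq_square)
  from this[of "(L - \<mu>) / 2" "y - x"]
  have "(norm (d - ((L - \<mu>) / 2) *\<^sub>R (y - x)))\<^sup>2 =
      (norm d)\<^sup>2 - (L - \<mu>) * (d \<bullet> (y - x)) + ((L - \<mu>) / 2 * norm (y - x))\<^sup>2"
    by simp
  ultimately have "(norm (d - ((L - \<mu>) / 2) *\<^sub>R (y - x)))\<^sup>2 \<le> ((L - \<mu>) / 2 * norm (y - x))\<^sup>2"
    by simp
  then have "norm (d - ((L - \<mu>) / 2) *\<^sub>R (y - x)) \<le> (L - \<mu>) / 2 * norm (y - x)"
    by (rule power2_le_imp_le) (simp add: \<open>\<mu> \<le> L\<close>)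
  moreover have "d - ((L - \<mu>) / 2) *\<^sub>R (y - x) = (grad f y - grad f x) - ((L + \<mu>) / 2) *\<^sub>R (y - x)"
  proof -
    have "(L + \<mu>) / 2 = \<mu> + (L - \<mu>) / 2"
      by (simp add: field_simps)
    then show ?thesis
      by (simp only: d_def D_def) (simp add: algebra_simps)
  qed
  ultimately show ?thesis
    by simp
qed

lemma rate_nonneg: "0 \<le> rate \<mu> L t"
  by (simp add: rate_def)

text \<open>The map \<open>\<delta> \<mapsto> e - t \<delta>\<close> sends the ball of the preceding lemma to one whose centre has norm
  and whose radius is, respectively, \<open>\<bar>1 - t (L + \<mu>) / 2\<bar>\<close> and \<open>t (L - \<mu>) / 2\<close> times \<open>\<parallel>e\<parallel>\<close>; their sum is the larger of the
  values of \<open>\<bar>1 - a t\<bar>\<close> at the endpoints \<open>a = \<mu>\<close> and \<open>a = L\<close>.\<close>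

lemma gradient_step_lipschitz:
  fixes f :: "'a::euclidean_space \<Rightarrow> real"
  assumes f: "L_smooth L f" "strongly_convex \<mu> f" and mL: "\<mu> \<le> L" and t: "0 \<le> t"
  shows "norm ((y - x) - t *\<^sub>R (grad f y - grad f x)) \<le> rate \<mu> L t * norm (y - x)"
proof -
  let ?e = "y - x" and ?d = "grad f y - grad f x" and ?c = "(L + \<mu>) / 2"
  have "?e - t *\<^sub>R ?d = (1 - t * ?c) *\<^sub>R ?e - t *\<^sub>R (?d - ?c *\<^sub>R ?e)"
    by (simp add: algebra_simps)
  then have "norm (?e - t *\<^sub>R ?d) \<le> \<bar>1 - t * ?c\<bar> * norm ?e + t * norm (?d - ?c *\<^sub>R ?e)"
    using norm_triangle_ineq4[of "(1 - t * ?c) *\<^sub>R ?e" "t *\<^sub>R (?d - ?c *\<^sub>R ?e)"] t by simp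
  also have "\<dots> \<le> \<bar>1 - t * ?c\<bar> * norm ?e + t * ((L - \<mu>) / 2 * norm ?e)"
    using grad_diff_in_ball[OF f mL, of y x] t by (intro add_left_mono mult_left_mono) auto
  also have "\<dots> = (\<bar>1 - t * ?c\<bar> + t * ((L - \<mu>) / 2)) * norm ?e"
    by (simp add: algebra_simps)
  also have "\<bar>1 - t * ?c\<bar> + t * ((L - \<mu>) / 2) = rate \<mu> L t"
  proof -
    have "t * \<mu> \<le> t * L"
      using mL t by (rule mult_left_mono)
    then show ?thesis
      unfolding rate_def by (auto simp: field_simps abs_if max_def)
  qed
  finally show ?thesis .
qed

section \<open>The chain of inequalities\<close>

lemma dist_to_0_le: "v \<in> S \<Longrightarrow> dist_to 0 S \<le> ereal (norm v)"
  unfolding dist_to_def by (rule INF_lower2[of v]) auto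

lemma le_dist_to_0I: "(\<And>v. v \<in> S \<Longrightarrow> c \<le> norm v) \<Longrightarrow> ereal c \<le> dist_to 0 S"
  unfolding dist_to_def by (rule INF_greatest) auto

text \<open>Writing a subgradient of \<open>\<phi>\<close> as \<open>\<nabla>f x + u\<close> with \<open>u \<in> \<partial>g x\<close>, the point \<open>x\<close> is the
  resolvent of \<open>x + t u\<close> while \<open>x\<^sup>+\<close> is the resolvent of \<open>x - t \<nabla>f x\<close>; the two inputs differ by
  \<open>t\<close> times the subgradient.\<close>

lemma norm_prox_gradient_le_dist_to:
  assumes D: "GDERIV f x :> grad f x" and g: "proper_closed_convex g" and t: "0 < t"
  shows "ereal (norm (prox_gradient t f g x)) \<le> dist_to 0 (subdiff (composite f g) x)"
proof (rule le_dist_to_0I)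
  fix v
  assume "v \<in> subdiff (composite f g) x"
  note gD = proper_closed_convexD[OF g]
  let ?G = "prox_gradient t f g x" and ?xp = "prox_grad_step t f g x"
  have xp: "?xp = x - t *\<^sub>R ?G"
    using t by (simp add: prox_grad_step_eq)
  have "v - grad f x \<in> subdiff g x"
    by (rule subdiff_composite_imp_diff_grad) fact+
  from resolvent_nonexpansive[OF gD(1) this prox_gradient_in_subdiff[OF g t, of f x], of t]
  have "norm (t *\<^sub>R ?G) \<le> norm (t *\<^sub>R v)"
    using t by (simp add: xp algebra_simps)
  then show "norm ?G \<le> norm v"
    using t by simp
qed

text \<open>Optimality of \<open>x\<^sup>+\<close> yields the explicit subgradient \<open>\<nabla>f x\<^sup>+ + (G x - \<nabla>f x)\<close> of \<open>\<phi>\<close>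
  at \<open>x\<^sup>+\<close>. Multiplied by \<open>t\<close> it is the difference of the gradient steps from \<open>x\<close> and from
  \<open>x\<^sup>+\<close>, so the Lipschitz modulus of the gradient step bounds it.\<close>

lemma dist_to_subdiff_step_le:
  fixes f :: "'a::euclidean_space \<Rightarrow> real"
  assumes f: "L_smooth L f" "strongly_convex \<mu> f" and mu: "0 \<le> \<mu>" "\<mu> \<le> L"
    and g: "proper_closed_convex g" and t: "0 < t"
  shows "dist_to 0 (subdiff (composite f g) (prox_grad_step t f g x))
    \<le> ereal (rate \<mu> L t * norm (prox_gradient t f g x))"
proof -
  let ?G = "prox_gradient t f g x" and ?xp = "prox_grad_step t f g x"
  let ?v = "grad f ?xp + (?G - grad f x)"
  have xp: "x - ?xp = t *\<^sub>R ?G"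
    using t by (simp add: prox_grad_step_eq)
  have "f ?xp + grad f ?xp \<bullet> (y - ?xp) \<le> f y" for y
  proof -
    have "0 \<le> \<mu> / 2 * (norm (y - ?xp))\<^sup>2"
      using mu by simp
    then show ?thesis
      using strongly_convex_lower_bound[OF f(2) L_smooth_GDERIV[OF f(1)], of ?xp y] by linarith
  qed
  then have "?v \<in> subdiff (composite f g) ?xp"
    by (rule add_grad_in_subdiff_composite) (rule prox_gradient_in_subdiff[OF g t])
  then have "dist_to 0 (subdiff (composite f g) ?xp) \<le> ereal (norm ?v)"
    by (rule dist_to_0_le)
  also have "norm ?v \<le> rate \<mu> L t * norm ?G"
  proof -
    have "t *\<^sub>R ?v = (x - ?xp) - t *\<^sub>R (grad f x - grad f ?xp)"
      unfolding xp by (simp add: algebra_simps)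
    then have "norm (t *\<^sub>R ?v) \<le> rate \<mu> L t * norm (t *\<^sub>R ?G)"
      using gradient_step_lipschitz[OF f mu(2), of t x ?xp] t xp by simp
    then show ?thesis
      using t by (simp add: mult.left_commute)
  qed
  finally show ?thesis
    by simp
qed

section \<open>Sharpness of the rate\<close>

lemma grad_quadratic: "grad (\<lambda>u. a / 2 * (norm u)\<^sup>2) x = a *\<^sub>R x"
  by (rule grad_eqI, unfold gderiv_def power2_norm_eq_inner)
    (auto intro!: derivative_eq_intros simp: inner_commute algebra_simps)

lemma L_smooth_quadratic:
  assumes "0 \<le> a" "a \<le> L"
  shows "L_smooth L (\<lambda>u::'a::euclidean_space. a / 2 * (norm u)\<^sup>2)"
  unfolding L_smooth_def
proof (intro conjI allI)
  fix x y :: 'a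
  show "(\<lambda>u::'a. a / 2 * (norm u)\<^sup>2) differentiable (at x)"
    unfolding power2_norm_eq_inner by (intro derivative_intros) auto
  have "norm (a *\<^sub>R x - a *\<^sub>R y) = a * norm (x - y)"
    using assms by (simp flip: scaleR_diff_right)
  also have "\<dots> \<le> L * norm (x - y)"
    using assms by (intro mult_right_mono) auto
  finally show "norm (grad (\<lambda>u::'a. a / 2 * (norm u)\<^sup>2) x - grad (\<lambda>u. a / 2 * (norm u)\<^sup>2) y)
      \<le> L * norm (x - y)"
    by (simp only: grad_quadratic)
qed

lemma strongly_convex_quadratic:
  assumes "\<mu> \<le> a"
  shows "strongly_convex \<mu> (\<lambda>u::'a::euclidean_space. a / 2 * (norm u)\<^sup>2)"
proof -
  have "convex_on UNIV (\<lambda>u::'a. (norm u)\<^sup>2)"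
  proof (rule convex_onI)
    fix s :: real and x y :: 'a
    assume "0 < s" "s < 1"
    then have "0 \<le> s * (1 - s) * (norm (x - y))\<^sup>2"
      by simp
    also have "\<dots> = (1 - s) * (norm x)\<^sup>2 + s * (norm y)\<^sup>2 - (norm ((1 - s) *\<^sub>R x + s *\<^sub>R y))\<^sup>2"
      unfolding power2_norm_eq_inner
      by (simp add: inner_diff_left inner_diff_right inner_add_left inner_add_right
          inner_commute algebra_simps)
    finally show "(norm ((1 - s) *\<^sub>R x + s *\<^sub>R y))\<^sup>2 \<le> (1 - s) * (norm x)\<^sup>2 + s * (norm y)\<^sup>2"
      by simp
  qed simp
  then have "convex_on UNIV (\<lambda>u::'a. (a - \<mu>) / 2 * (norm u)\<^sup>2)"
    using assms by (intro convex_on_cmul) auto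
  then show ?thesis
    by (simp add: strongly_convex_def algebra_simps diff_divide_distrib)
qed

lemma proper_closed_convex_0: "proper_closed_convex (\<lambda>_. 0)"
proof -
  have epi: "ereal_epigraph (\<lambda>_::'a. 0) = UNIV \<times> {0..}"
    by (auto simp: ereal_epigraph_def)
  show ?thesis
    by (auto simp: proper_closed_convex_def proper_fun_def closed_fun_def convex_fun_def epi
        intro!: closed_Times convex_Times)
qed

lemma prox_gradient_0:
  assumes t: "0 < t"
  shows "prox_gradient t f (\<lambda>_. 0) x = grad f x"
proof -
  have v: "v = 0" if "v \<in> subdiff (\<lambda>_. 0) y" for v y :: 'a
    using that spec[of "\<lambda>w. v \<bullet> (w - y) \<le> 0" "y + v"] inner_ge_zero[of v]
    by (simp add: subdiff_def)
  show ?thesis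
    using v[OF prox_gradient_in_subdiff[OF proper_closed_convex_0 t, of f x]] by simp
qed

text \<open>With \<open>g = 0\<close> and \<open>f = a/2 \<parallel>\<cdot>\<parallel>\<^sup>2\<close> the method is gradient descent on a quadratic, which
  multiplies \<open>x\<close>, and hence the gradient \<open>a x\<close>, by exactly \<open>1 - a t\<close>.\<close>

lemma contraction_factor_lower_bound:
  assumes a: "0 < \<mu>" "\<mu> \<le> a" "a \<le> L" and t: "0 < t"
    and c: "\<And>(f :: 'a::euclidean_space \<Rightarrow> real) g x.
      L_smooth L f \<Longrightarrow> strongly_convex \<mu> f \<Longrightarrow> proper_closed_convex g \<Longrightarrow>
      norm (prox_gradient t f g (prox_grad_step t f g x)) \<le> c * norm (prox_gradient t f g x)"
  shows "\<bar>1 - a * t\<bar> \<le> c"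
proof -
  let ?f = "\<lambda>u::'a. a / 2 * (norm u)\<^sup>2"
  obtain e :: 'a where e: "norm e = 1"
    using vector_choose_size[of 1] by auto
  have "norm (prox_gradient t ?f (\<lambda>_. 0) (prox_grad_step t ?f (\<lambda>_. 0) e))
      \<le> c * norm (prox_gradient t ?f (\<lambda>_. 0) e)"
    by (rule c[OF L_smooth_quadratic strongly_convex_quadratic proper_closed_convex_0]) (use a in auto)
  moreover have "prox_grad_step t ?f (\<lambda>_. 0) e = (1 - a * t) *\<^sub>R e"
    using t by (simp add: prox_grad_step_eq prox_gradient_0 grad_quadratic scaleR_diff_left
        del: times_divide_eq_left)
  ultimately have "a * \<bar>1 - a * t\<bar> \<le> a * c"
    using a e t by (simp add: prox_gradient_0 grad_quadratic abs_mult mult.commute[of c]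
        del: times_divide_eq_left)
  then show ?thesis
    using a by simp
qed

section \<open>Convergence of the proximal gradient norm\<close>

theorem theorem3p1:
  shows
    "(\<forall>(\<mu>::real) (L::real) (t::real). 0 < \<mu> \<and> \<mu> \<le> L \<and> 0 < t \<longrightarrow>
        (\<forall>(f :: real ^ 'n \<Rightarrow> real) (g :: real ^ 'n \<Rightarrow> ereal) (x :: real ^ 'n).
           L_smooth L f \<and> strongly_convex \<mu> f \<and> proper_closed_convex g \<longrightarrow>
           (let xp = prox_grad_step t f g x; \<phi> = composite f g in
              ereal (norm (prox_gradient t f g xp)) \<le> dist_to 0 (subdiff \<phi> xp) \<and>
              dist_to 0 (subdiff \<phi> xp) \<le> ereal (rate \<mu> L t * norm (prox_gradient t f g x)) \<and>
              ereal (rate \<mu> L t * norm (prox_gradient t f g x))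
                \<le> ereal (rate \<mu> L t) * dist_to 0 (subdiff \<phi> x))) \<and>
        \<not> (\<exists>c < rate \<mu> L t.
             \<forall>(f :: real ^ 'n \<Rightarrow> real) (g :: real ^ 'n \<Rightarrow> ereal) (x :: real ^ 'n).
               L_smooth L f \<and> strongly_convex \<mu> f \<and> proper_closed_convex g \<longrightarrow>
               norm (prox_gradient t f g (prox_grad_step t f g x))
                 \<le> c * norm (prox_gradient t f g x))) \<and>
     (\<forall>(L::real) (t::real) (f :: real ^ 'n \<Rightarrow> real) (g :: real ^ 'n \<Rightarrow> ereal) (x :: real ^ 'n).
        0 < L \<and> convex_on UNIV f \<and> L_smooth L f \<and> proper_closed_convex g \<and> 0 < t \<and> t \<le> 2 / L \<longrightarrow>
        (let xp = prox_grad_step t f g x; \<phi> = composite f g in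
           ereal (norm (prox_gradient t f g xp)) \<le> dist_to 0 (subdiff \<phi> xp) \<and>
           dist_to 0 (subdiff \<phi> xp) \<le> ereal (norm (prox_gradient t f g x)) \<and>
           ereal (norm (prox_gradient t f g x)) \<le> dist_to 0 (subdiff \<phi> x)))"
proof (intro conjI allI impI; (elim conjE)?)
  fix \<mu> L t :: real and f :: "real ^ 'n \<Rightarrow> real" and g :: "real ^ 'n \<Rightarrow> ereal" and x :: "real ^ 'n"
  assume mu: "0 < \<mu>" "\<mu> \<le> L" and t: "0 < t"
    and f: "L_smooth L f" "strongly_convex \<mu> f" and g: "proper_closed_convex g"
  have "ereal (rate \<mu> L t) * ereal (norm (prox_gradient t f g x))
      \<le> ereal (rate \<mu> L t) * dist_to 0 (subdiff (composite f g) x)"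
    using norm_prox_gradient_le_dist_to[OF L_smooth_GDERIV[OF f(1)] g t]
    by (rule ereal_mult_left_mono) (simp add: rate_nonneg)
  then show "let xp = prox_grad_step t f g x; \<phi> = composite f g in
      ereal (norm (prox_gradient t f g xp)) \<le> dist_to 0 (subdiff \<phi> xp) \<and>
      dist_to 0 (subdiff \<phi> xp) \<le> ereal (rate \<mu> L t * norm (prox_gradient t f g x)) \<and>
      ereal (rate \<mu> L t * norm (prox_gradient t f g x)) \<le> ereal (rate \<mu> L t) * dist_to 0 (subdiff \<phi> x)"
    using norm_prox_gradient_le_dist_to[OF L_smooth_GDERIV[OF f(1)] g t]
      dist_to_subdiff_step_le[OF f _ mu(2) g t] mu
    by (simp add: Let_def)
next
  fix \<mu> L t :: real
  assume mu: "0 < \<mu>" "\<mu> \<le> L" and t: "0 < t"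
  show "\<not> (\<exists>c < rate \<mu> L t.
      \<forall>(f :: real ^ 'n \<Rightarrow> real) (g :: real ^ 'n \<Rightarrow> ereal) (x :: real ^ 'n).
        L_smooth L f \<and> strongly_convex \<mu> f \<and> proper_closed_convex g \<longrightarrow>
        norm (prox_gradient t f g (prox_grad_step t f g x)) \<le> c * norm (prox_gradient t f g x))"
  proof (rule notI, elim exE conjE)
    fix c
    assume "c < rate \<mu> L t"
      and c: "\<forall>(f :: real ^ 'n \<Rightarrow> real) (g :: real ^ 'n \<Rightarrow> ereal) (x :: real ^ 'n).
        L_smooth L f \<and> strongly_convex \<mu> f \<and> proper_closed_convex g \<longrightarrow>
        norm (prox_gradient t f g (prox_grad_step t f g x)) \<le> c * norm (prox_gradient t f g x)"
    have "\<bar>1 - a * t\<bar> \<le> c" if "\<mu> \<le> a" "a \<le> L" for a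
      using mu(1) that t by (rule contraction_factor_lower_bound) (use c in blast)
    from this[of \<mu>] this[of L] show False
      using mu \<open>c < rate \<mu> L t\<close> by (simp add: rate_def)
  qed
next
  fix L t :: real and f :: "real ^ 'n \<Rightarrow> real" and g :: "real ^ 'n \<Rightarrow> ereal" and x :: "real ^ 'n"
  assume L: "0 < L" and f: "convex_on UNIV f" "L_smooth L f" and g: "proper_closed_convex g"
    and t: "0 < t" "t \<le> 2 / L"
  have sc: "strongly_convex 0 f"
    using f(1) by (simp add: strongly_convex_def)
  have "rate 0 L t = 1"
    using L t by (simp add: rate_def field_simps max_def abs_if)
  then show "let xp = prox_grad_step t f g x; \<phi> = composite f g in
      ereal (norm (prox_gradient t f g xp)) \<le> dist_to 0 (subdiff \<phi> xp) \<and>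
      dist_to 0 (subdiff \<phi> xp) \<le> ereal (norm (prox_gradient t f g x)) \<and>
      ereal (norm (prox_gradient t f g x)) \<le> dist_to 0 (subdiff \<phi> x)"
    using norm_prox_gradient_le_dist_to[OF L_smooth_GDERIV[OF f(2)] g t(1)]
      dist_to_subdiff_step_le[OF f(2) sc _ _ g t(1), of x] L
    by (simp add: Let_def)
qed

end
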